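(* Let $D$ be a Prüfer domain and let $P\in\mathrm{Spec}(D)$. Then $P$ is sharp if and only if $\widetilde{\mathtt{s}_{\Delta(P)}}\lneq\widetilde{\mathtt{s}_{\nabla(P)}}$.
   Context: Let $D$ be an integral domain with quotient field $K$. Denote by $\overline{\boldsymbol F}(D)$ the set of nonzero $D$-submodules of $K$ and by $\boldsymbol f(D)$ the set of nonzero finitely generated $D$-submodules of $K$. A semistar operation on $D$ is a map $\star:\overline{\boldsymbol F}(D)\to\overline{\boldsymbol F}(D)$, $E\mapsto E^\star$, such that for all $0\ne x\in K$ and $E,F\in\overline{\boldsymbol F}(D)$: $(xE)^\star=xE^\star$; $E\subseteq F$ implies $E^\star\subseteq F^\star$; $E\subseteq E^\star$ and $(E^\star)^\star=E^\star$. Write $\star_1\le\star_2$ if $E^{\star_1}\subseteq E^{\star_2}$ for all $E\in\overline{\boldsymbol F}(D)$, and $\star_1\lneq\star_2$ if moreover $\star_1\neq\star_2$. The associated finite-type operation is $E^{\star_f}:=\bigcup\{F^\star\mid F\in\boldsymbol f(D),\,F\subseteq E\}$. A nonzero ideal $I$ of $D$ is a quasi-$\star$-ideal if $I^\star\cap D=I$; $\mathrm{QMax}^{\star}(D)$ is the set of ideals maximal among the proper quasi-$\star$-ideals. For $Y\subseteq\mathrm{Spec}(D)$, $\mathtt{s}_Y$ is the semistar operation $E^{\mathtt{s}_Y}:=\bigcap\{ED_Q\mid Q\in Y\}$, with $E^{\mathtt{s}_\emptyset}:=K$. For a semistar operation $\star$, $\widetilde\star:=\mathtt{s}_{\mathrm{QMax}^{\star_f}(D)}$.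 For $P\in\mathrm{Spec}(D)$: $\nabla(P):=\{M\in\mathrm{Max}(D)\mid M\nsupseteq P\}$, $\Delta(P):=\nabla(P)\cup\{P\}$, $\Theta(P):=\bigcap\{D_M\mid M\in\nabla(P)\}$ (an empty intersection is $K$). $P$ is sharp if $\Theta(P)\nsubseteq D_P$. *)

theory Defs
  imports "HOL-Algebra.Algebra"
begin

text \<open>
  An integral domain is given as a subring \<open>D\<close> of its quotient field \<open>K\<close>.
  The ring \<open>D\<close> itself is the record \<open>K\<lparr>carrier := D\<rparr>\<close>.
\<close>

locale quotient_field = field K for K (structure) +
  fixes D :: "'a set"
  assumes subdomain: "subdomain D K"
    and fraction: "x \<in> carrier K \<Longrightarrow> \<exists>a\<in>D. \<exists>b\<in>D - {\<zero>}. x = a \<otimes> inv b"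

abbreviation sub_ring :: "('a, 'b) ring_scheme \<Rightarrow> 'a set \<Rightarrow> ('a, 'b) ring_scheme"
  where "sub_ring K D \<equiv> K\<lparr>carrier := D\<rparr>"

definition self_module :: "('a, 'b) ring_scheme \<Rightarrow> ('a, 'a) module"
  where "self_module K =
    \<lparr>carrier = carrier K, monoid.mult = (\<otimes>\<^bsub>K\<^esub>), one = \<one>\<^bsub>K\<^esub>,
     ring.zero = \<zero>\<^bsub>K\<^esub>, ring.add = (\<oplus>\<^bsub>K\<^esub>), smult = (\<otimes>\<^bsub>K\<^esub>)\<rparr>"


subsection \<open>Submodules of the quotient field\<close>

definition submodules :: "('a, 'b) ring_scheme \<Rightarrow> 'a set \<Rightarrow> 'a set set"
  where "submodules K D = {E. submodule E (sub_ring K D) (self_module K) \<and> E \<noteq> {\<zero>\<^bsub>K\<^esub>}}"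

definition fg_submodules :: "('a, 'b) ring_scheme \<Rightarrow> 'a set \<Rightarrow> 'a set set"
  where "fg_submodules K D =
    {F \<in> submodules K D. \<exists>S. finite S \<and> S \<subseteq> carrier K \<and>
       F = \<Inter>{E. submodule E (sub_ring K D) (self_module K) \<and> S \<subseteq> E}}"

text \<open>
  The product \<open>E \<cdot>\<^bsub>K\<^esub> F\<close> (\<^const>\<open>ideal_prod\<close>) consists of the finite sums of
  products \<open>e \<otimes>\<^bsub>K\<^esub> f\<close>. It does not require its arguments to be ideals of \<open>K\<close>, and is used
  here for \<open>D\<close>-submodules of \<open>K\<close>.
\<close>

definition pruefer_domain :: "('a, 'b) ring_scheme \<Rightarrow> 'a set \<Rightarrow> bool"
  where "pruefer_domain K D \<longleftrightarrow> quotient_field K D \<and>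
    (\<forall>S. finite S \<and> S \<subseteq> D \<and> Idl\<^bsub>sub_ring K D\<^esub> S \<noteq> {\<zero>\<^bsub>K\<^esub>} \<longrightarrow>
      (\<exists>J\<in>submodules K D. (Idl\<^bsub>sub_ring K D\<^esub> S) \<cdot>\<^bsub>K\<^esub> J = D))"


subsection \<open>Semistar operations\<close>

text \<open>
  A map on nonzero submodules is represented by a function on all subsets of \<open>K\<close>; only its values
  on \<^term>\<open>submodules K D\<close> matter. Accordingly, the equality of two such maps that is negated in
  \<open>semistar_less\<close> is equality on \<^term>\<open>submodules K D\<close>.
\<close>

definition semistar_operation :: "('a, 'b) ring_scheme \<Rightarrow> 'a set \<Rightarrow> ('a set \<Rightarrow> 'a set) \<Rightarrow> bool"
  where "semistar_operation K D star \<longleftrightarrow>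
    star \<in> submodules K D \<rightarrow> submodules K D \<and>
    (\<forall>E\<in>submodules K D. \<forall>x\<in>carrier K - {\<zero>\<^bsub>K\<^esub>}. star (x <#\<^bsub>K\<^esub> E) = x <#\<^bsub>K\<^esub> star E) \<and>
    (\<forall>E\<in>submodules K D. \<forall>F\<in>submodules K D. E \<subseteq> F \<longrightarrow> star E \<subseteq> star F) \<and>
    (\<forall>E\<in>submodules K D. E \<subseteq> star E \<and> star (star E) = star E)"

definition semistar_le ::
  "('a, 'b) ring_scheme \<Rightarrow> 'a set \<Rightarrow> ('a set \<Rightarrow> 'a set) \<Rightarrow> ('a set \<Rightarrow> 'a set) \<Rightarrow> bool"
  where "semistar_le K D star1 star2 \<longleftrightarrow> (\<forall>E\<in>submodules K D. star1 E \<subseteq> star2 E)"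

definition semistar_less ::
  "('a, 'b) ring_scheme \<Rightarrow> 'a set \<Rightarrow> ('a set \<Rightarrow> 'a set) \<Rightarrow> ('a set \<Rightarrow> 'a set) \<Rightarrow> bool"
  where "semistar_less K D star1 star2 \<longleftrightarrow>
    semistar_le K D star1 star2 \<and> \<not> (\<forall>E\<in>submodules K D. star1 E = star2 E)"

definition finite_type ::
  "('a, 'b) ring_scheme \<Rightarrow> 'a set \<Rightarrow> ('a set \<Rightarrow> 'a set) \<Rightarrow> 'a set \<Rightarrow> 'a set"
  where "finite_type K D star E = \<Union>{star F | F. F \<in> fg_submodules K D \<and> F \<subseteq> E}"

definition quasi_star_ideal ::
  "('a, 'b) ring_scheme \<Rightarrow> 'a set \<Rightarrow> ('a set \<Rightarrow> 'a set) \<Rightarrow> 'a set \<Rightarrow> bool"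
  where "quasi_star_ideal K D star I \<longleftrightarrow>
    ideal I (sub_ring K D) \<and> I \<noteq> {\<zero>\<^bsub>K\<^esub>} \<and> star I \<inter> D = I"

definition QMax :: "('a, 'b) ring_scheme \<Rightarrow> 'a set \<Rightarrow> ('a set \<Rightarrow> 'a set) \<Rightarrow> 'a set set"
  where "QMax K D star = {I. quasi_star_ideal K D star I \<and> I \<noteq> D \<and>
    (\<forall>J. quasi_star_ideal K D star J \<and> J \<noteq> D \<and> I \<subseteq> J \<longrightarrow> J = I)}"


subsection \<open>Prime ideals and spectral operations\<close>

definition Spec :: "('a, 'b) ring_scheme \<Rightarrow> 'a set \<Rightarrow> 'a set set"
  where "Spec K D = {P. primeideal P (sub_ring K D)}"

definition MaxSpec :: "('a, 'b) ring_scheme \<Rightarrow> 'a set \<Rightarrow> 'a set set"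
  where "MaxSpec K D = {M. maximalideal M (sub_ring K D)}"

definition localization :: "('a, 'b) ring_scheme \<Rightarrow> 'a set \<Rightarrow> 'a set \<Rightarrow> 'a set"
  where "localization K D Q = {a \<otimes>\<^bsub>K\<^esub> inv\<^bsub>K\<^esub> s | a s. a \<in> D \<and> s \<in> D - Q}"

text \<open>Intersecting with the carrier makes the operation for \<open>Y = {}\<close> the constant map \<open>K\<close>.\<close>

definition spectral :: "('a, 'b) ring_scheme \<Rightarrow> 'a set \<Rightarrow> 'a set set \<Rightarrow> 'a set \<Rightarrow> 'a set"
  where "spectral K D Y E = carrier K \<inter> (\<Inter>Q\<in>Y. E \<cdot>\<^bsub>K\<^esub> localization K D Q)"

definition tilde ::
  "('a, 'b) ring_scheme \<Rightarrow> 'a set \<Rightarrow> ('a set \<Rightarrow> 'a set) \<Rightarrow> 'a set \<Rightarrow> 'a set"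
  where "tilde K D star = spectral K D (QMax K D (finite_type K D star))"

definition Nabla :: "('a, 'b) ring_scheme \<Rightarrow> 'a set \<Rightarrow> 'a set \<Rightarrow> 'a set set"
  where "Nabla K D P = {M \<in> MaxSpec K D. \<not> P \<subseteq> M}"

definition Delta :: "('a, 'b) ring_scheme \<Rightarrow> 'a set \<Rightarrow> 'a set \<Rightarrow> 'a set set"
  where "Delta K D P = Nabla K D P \<union> {P}"

definition Theta :: "('a, 'b) ring_scheme \<Rightarrow> 'a set \<Rightarrow> 'a set \<Rightarrow> 'a set"
  where "Theta K D P = carrier K \<inter> (\<Inter>M\<in>Nabla K D P. localization K D M)"

definition sharp :: "('a, 'b) ring_scheme \<Rightarrow> 'a set \<Rightarrow> 'a set \<Rightarrow> bool"
  where "sharp K D P \<longleftrightarrow> \<not> Theta K D P \<subseteq> localization K D P"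


subsection \<open>The operations are well defined\<close>

context quotient_field
begin

lemma D_subring: "subring D K"
  using subdomain by (simp add: subdomain_def subcring_def)

lemma D_carrier: "D \<subseteq> carrier K"
  using subringE(1)[OF D_subring] .

lemma D_domain: "domain (sub_ring K D)"
  using subdomain subdomain_iff D_carrier by blast

lemma self_module_simps [simp]:
  "carrier (self_module K) = carrier K" "\<zero>\<^bsub>self_module K\<^esub> = \<zero>"
  "x \<oplus>\<^bsub>self_module K\<^esub> y = x \<oplus> y" "x \<odot>\<^bsub>self_module K\<^esub> y = x \<otimes> y"
  by (simp_all add: self_module_def)

lemma module_self_module: "module (sub_ring K D) (self_module K)"
proof -
  have D: "a \<in> carrier K" if "a \<in> D" for a
    using that D_carrier by blast
  have "cring (sub_ring K D)"
    using D_domain by (simp add: domain_def)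
  moreover have "abelian_group (self_module K)"
  proof (rule abelian_groupI)
    fix x assume "x \<in> carrier (self_module K)"
    then show "\<exists>y\<in>carrier (self_module K). y \<oplus>\<^bsub>self_module K\<^esub> x = \<zero>\<^bsub>self_module K\<^esub>"
      using l_neg[of x] by (auto intro!: bexI[of _ "\<ominus> x"])
  qed (simp_all add: a_ac)
  ultimately show ?thesis
    by (auto simp: module_def module_axioms_def l_distr r_distr m_assoc dest!: D)
qed

lemma a_inv_self_module: "x \<in> carrier K \<Longrightarrow> \<ominus>\<^bsub>self_module K\<^esub> x = \<ominus> x"
  using module_self_module a_inv_closed
  by (metis abelian_group.minus_equality l_neg module.axioms(2) self_module_simps(1,2,3))

lemma submodule_iff:
  "submodule E (sub_ring K D) (self_module K) \<longleftrightarrow>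
    E \<subseteq> carrier K \<and> \<zero> \<in> E \<and> (\<forall>x\<in>E. \<forall>y\<in>E. x \<oplus> y \<in> E) \<and> (\<forall>a\<in>D. \<forall>x\<in>E. a \<otimes> x \<in> E)"
  (is "?L \<longleftrightarrow> ?R")
proof
  assume ?L
  then show ?R
    using submodule.smult_closed[of E "sub_ring K D" "self_module K"]
      subgroup.subset[of E "add_monoid (self_module K)"]
      subgroup.one_closed[of E "add_monoid (self_module K)"]
      subgroup.m_closed[of E "add_monoid (self_module K)"]
    by (auto simp: submodule_def)
next
  assume R: ?R
  have "\<ominus> x \<in> E" if "x \<in> E" for x
  proof -
    have "\<ominus> \<one> \<in> D"
      using D_subring by (simp add: subringE(3,5))
    moreover have "\<ominus> x = \<ominus> \<one> \<otimes> x"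
      using that R by (simp add: l_minus subset_iff)
    ultimately show ?thesis
      using that R by simp
  qed
  then show ?L
    using R by (intro module.submoduleI[OF module_self_module])
      (auto simp: a_inv_self_module subset_iff)
qed

lemma submodules_iff:
  "E \<in> submodules K D \<longleftrightarrow> E \<noteq> {\<zero>} \<and>
    E \<subseteq> carrier K \<and> \<zero> \<in> E \<and> (\<forall>x\<in>E. \<forall>y\<in>E. x \<oplus> y \<in> E) \<and> (\<forall>a\<in>D. \<forall>x\<in>E. a \<otimes> x \<in> E)"
  by (auto simp: submodules_def submodule_iff)

lemma prime_complement:
  assumes "Q \<in> Spec K D"
  shows "\<one> \<in> D - Q" "\<zero> \<notin> D - Q" "\<And>s t. s \<in> D - Q \<Longrightarrow> t \<in> D - Q \<Longrightarrow> s \<otimes> t \<in> D - Q"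
proof -
  interpret Q: primeideal Q "sub_ring K D"
    using assms by (simp add: Spec_def)
  show "\<zero> \<notin> D - Q"
    using additive_subgroup.zero_closed[OF Q.is_additive_subgroup] by simp
  show "\<one> \<in> D - Q"
    using Q.I_notcarr Q.one_imp_carrier subringE(3)[OF D_subring] by auto
  show "s \<otimes> t \<in> D - Q" if "s \<in> D - Q" "t \<in> D - Q" for s t
    using that Q.I_prime[of s t] subringE(6)[OF D_subring] by auto
qed

lemma mem_localized_iff:
  assumes Q: "Q \<in> Spec K D" and E: "E \<in> submodules K D"
  shows "x \<in> E \<cdot>\<^bsub>K\<^esub> localization K D Q \<longleftrightarrow> x \<in> carrier K \<and> (\<exists>s\<in>D - Q. s \<otimes> x \<in> E)"
    (is "?L \<longleftrightarrow> ?R")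
proof
  note [simp] = subsetD[OF D_carrier]
  have Ec [simp]: "e \<in> E \<Longrightarrow> e \<in> carrier K" for e
    using E by (auto simp: submodules_iff)
  have inv: "inv s \<in> carrier K" "s \<otimes> inv s = \<one>" if "s \<in> D - Q" for s
  proof -
    have "s \<in> Units K"
      using that prime_complement(2)[OF Q] by (auto simp: field_Units)
    then show "inv s \<in> carrier K" "s \<otimes> inv s = \<one>"
      by simp_all
  qed
  show ?R if ?L
    using that
  proof (induction rule: ideal_prod.induct)
    case (prod e j)
    then obtain a s where as: "a \<in> D" "s \<in> D - Q" "j = a \<otimes> inv s"
      by (auto simp: localization_def)
    have "s \<otimes> (e \<otimes> j) = (s \<otimes> inv s) \<otimes> (a \<otimes> e)"
      using as prod inv(1)[OF as(2)] by (simp add: m_ac)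
    also have "\<dots> \<in> E"
      using as prod inv[OF as(2)] E by (simp add: submodules_iff)
    finally show ?case
      using as prod inv by auto
  next
    case (sum x y)
    then obtain s t where st: "s \<in> D - Q" "s \<otimes> x \<in> E" "t \<in> D - Q" "t \<otimes> y \<in> E"
      by blast
    have "(s \<otimes> t) \<otimes> (x \<oplus> y) = t \<otimes> (s \<otimes> x) \<oplus> s \<otimes> (t \<otimes> y)"
      using st sum by (simp add: r_distr m_ac)
    also have "\<dots> \<in> E"
      using st E by (simp add: submodules_iff)
    finally show ?case
      using sum prime_complement(3)[OF Q st(1,3)] by blast
  qed
  show ?L if R: ?R
  proof -
    obtain s where s: "s \<in> D - Q" "s \<otimes> x \<in> E"
      using R by blast
    have "\<one> \<otimes> inv s \<in> localization K D Q"
      using s subringE(3)[OF D_subring] by (auto simp: localization_def)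
    then have "(s \<otimes> x) \<otimes> (\<one> \<otimes> inv s) \<in> E \<cdot>\<^bsub>K\<^esub> localization K D Q"
      using s by (intro ideal_prod.prod)
    moreover have "(s \<otimes> x) \<otimes> (\<one> \<otimes> inv s) = (s \<otimes> inv s) \<otimes> x"
      using R s inv(1)[OF s(1)] by (simp add: m_ac)
    ultimately show ?thesis
      using inv[OF s(1)] R by simp
  qed
qed

lemma spectral_iff:
  assumes "Y \<subseteq> Spec K D" "E \<in> submodules K D"
  shows "x \<in> spectral K D Y E \<longleftrightarrow> x \<in> carrier K \<and> (\<forall>Q\<in>Y. \<exists>s\<in>D - Q. s \<otimes> x \<in> E)"
  using mem_localized_iff[OF subsetD[OF assms(1)] assms(2)] by (auto simp: spectral_def)

lemma scaled_submodule:
  assumes E: "E \<in> submodules K D" and x: "x \<in> carrier K - {\<zero>}"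
  shows "x <#\<^bsub>K\<^esub> E \<in> submodules K D"
proof -
  note [simp] = subsetD[OF D_carrier]
  have Ec [simp]: "e \<in> E \<Longrightarrow> e \<in> carrier K" for e
    using E by (auto simp: submodules_iff)
  have mem: "y \<in> x <#\<^bsub>K\<^esub> E \<longleftrightarrow> (\<exists>e\<in>E. y = x \<otimes> e)" for y
    by (auto simp: l_coset_def)
  obtain e where "e \<in> E" "e \<noteq> \<zero>"
    using E by (auto simp: submodules_iff)
  then have "x \<otimes> e \<in> x <#\<^bsub>K\<^esub> E" "x \<otimes> e \<noteq> \<zero>"
    using x by (auto simp: mem integral_iff)
  then have "x <#\<^bsub>K\<^esub> E \<noteq> {\<zero>}"
    by auto
  moreover have "y \<oplus> z \<in> x <#\<^bsub>K\<^esub> E" if "y \<in> x <#\<^bsub>K\<^esub> E" "z \<in> x <#\<^bsub>K\<^esub> E" for y z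
  proof -
    obtain e f where "e \<in> E" "f \<in> E" "y = x \<otimes> e" "z = x \<otimes> f"
      using \<open>y \<in> x <#\<^bsub>K\<^esub> E\<close> \<open>z \<in> x <#\<^bsub>K\<^esub> E\<close> unfolding mem by blast
    moreover from this have "y \<oplus> z = x \<otimes> (e \<oplus> f)"
      using x by (simp add: r_distr)
    ultimately show ?thesis
      using E unfolding mem submodules_iff by blast
  qed
  moreover have "a \<otimes> y \<in> x <#\<^bsub>K\<^esub> E" if "a \<in> D" "y \<in> x <#\<^bsub>K\<^esub> E" for a y
  proof -
    obtain e where "e \<in> E" "y = x \<otimes> e"
      using \<open>y \<in> x <#\<^bsub>K\<^esub> E\<close> unfolding mem by blast
    moreover from this have "a \<otimes> y = x \<otimes> (a \<otimes> e)"
      using x that by (simp add: m_lcomm)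
    ultimately show ?thesis
      using E that(1) unfolding mem submodules_iff by blast
  qed
  moreover have "\<zero> \<in> x <#\<^bsub>K\<^esub> E"
    using E x by (auto simp: mem submodules_iff intro!: bexI[of _ \<zero>])
  moreover have "x <#\<^bsub>K\<^esub> E \<subseteq> carrier K"
    using x by (auto simp: mem)
  ultimately show ?thesis
    by (simp add: submodules_iff)
qed

proposition semistar_operation_spectral:
  assumes Y: "Y \<subseteq> Spec K D"
  shows "semistar_operation K D (spectral K D Y)"
proof -
  note [simp] = subsetD[OF D_carrier]
  note iff = spectral_iff[OF Y]
  have ext: "E \<subseteq> spectral K D Y E" if E: "E \<in> submodules K D" for E
  proof
    fix e assume e: "e \<in> E"
    then have "e \<in> carrier K"
      using E by (auto simp: submodules_iff)
    moreover have "\<exists>s\<in>D - Q. s \<otimes> e \<in> E" if "Q \<in> Y" for Q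
    proof
      show "\<one> \<in> D - Q"
        using that Y prime_complement(1) by blast
      show "\<one> \<otimes> e \<in> E"
        using e \<open>e \<in> carrier K\<close> by simp
    qed
    ultimately show "e \<in> spectral K D Y E"
      using iff[OF E] by simp
  qed
  have closed: "spectral K D Y E \<in> submodules K D" if E: "E \<in> submodules K D" for E
  proof -
    have plus: "x \<oplus> y \<in> spectral K D Y E"
      if xy: "x \<in> spectral K D Y E" "y \<in> spectral K D Y E" for x y
    proof -
      have c [simp]: "x \<in> carrier K" "y \<in> carrier K"
        using xy by (simp_all add: iff[OF E])
      have "\<exists>u\<in>D - Q. u \<otimes> (x \<oplus> y) \<in> E" if Q: "Q \<in> Y" for Q
      proof -
        obtain s t where st: "s \<in> D - Q" "s \<otimes> x \<in> E" "t \<in> D - Q" "t \<otimes> y \<in> E"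
          using xy Q unfolding iff[OF E] by blast
        have "(s \<otimes> t) \<otimes> (x \<oplus> y) = t \<otimes> (s \<otimes> x) \<oplus> s \<otimes> (t \<otimes> y)"
          using st by (simp add: r_distr m_ac)
        also have "\<dots> \<in> E"
          using st E by (simp add: submodules_iff)
        finally show ?thesis
          using prime_complement(3)[of Q s t] Q Y st by blast
      qed
      then show ?thesis
        by (simp add: iff[OF E])
    qed
    have scale: "a \<otimes> x \<in> spectral K D Y E" if ax: "a \<in> D" "x \<in> spectral K D Y E" for a x
    proof -
      have c [simp]: "x \<in> carrier K"
        using ax by (simp add: iff[OF E])
      have "\<exists>u\<in>D - Q. u \<otimes> (a \<otimes> x) \<in> E" if Q: "Q \<in> Y" for Q
      proof -
        obtain s where s: "s \<in> D - Q" "s \<otimes> x \<in> E"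
          using ax Q unfolding iff[OF E] by blast
        have "s \<otimes> (a \<otimes> x) = a \<otimes> (s \<otimes> x)"
          using s ax by (simp add: m_lcomm)
        also have "\<dots> \<in> E"
          using s ax E by (simp add: submodules_iff)
        finally show ?thesis
          using s by blast
      qed
      then show ?thesis
        using ax by (simp add: iff[OF E])
    qed
    have "spectral K D Y E \<noteq> {\<zero>}" "\<zero> \<in> spectral K D Y E"
      using ext[OF E] E by (auto simp: submodules_iff)
    then show ?thesis
      using plus scale by (auto simp: submodules_iff spectral_def)
  qed
  have mono: "spectral K D Y E \<subseteq> spectral K D Y F"
    if "E \<in> submodules K D" "F \<in> submodules K D" "E \<subseteq> F" for E F
    using that unfolding subset_iff[of "spectral K D Y E"] iff[OF that(1)] iff[OF that(2)] by blast
  have idem: "spectral K D Y (spectral K D Y E) = spectral K D Y E"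
    if E: "E \<in> submodules K D" for E
  proof
    show "spectral K D Y E \<subseteq> spectral K D Y (spectral K D Y E)"
      using ext closed E by blast
    show "spectral K D Y (spectral K D Y E) \<subseteq> spectral K D Y E"
    proof
      fix x assume x: "x \<in> spectral K D Y (spectral K D Y E)"
      then have c [simp]: "x \<in> carrier K"
        by (simp add: spectral_def)
      have "\<exists>u\<in>D - Q. u \<otimes> x \<in> E" if Q: "Q \<in> Y" for Q
      proof -
        obtain s where s: "s \<in> D - Q" "s \<otimes> x \<in> spectral K D Y E"
          using x Q unfolding iff[OF closed[OF E]] by blast
        then obtain t where t: "t \<in> D - Q" "t \<otimes> (s \<otimes> x) \<in> E"
          using Q unfolding iff[OF E] by blast
        then have "(t \<otimes> s) \<otimes> x \<in> E"
          using s by (simp add: m_assoc)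
        then show ?thesis
          using prime_complement(3)[of Q t s] Q Y s t by blast
      qed
      then show "x \<in> spectral K D Y E"
        by (simp add: iff[OF E])
    qed
  qed
  have hom: "spectral K D Y (x <#\<^bsub>K\<^esub> E) = x <#\<^bsub>K\<^esub> spectral K D Y E"
    if E: "E \<in> submodules K D" and x: "x \<in> carrier K - {\<zero>}" for E x
  proof -
    have Ec [simp]: "e \<in> E \<Longrightarrow> e \<in> carrier K" for e
      using E by (auto simp: submodules_iff)
    have mem: "y \<in> x <#\<^bsub>K\<^esub> A \<longleftrightarrow> (\<exists>e\<in>A. y = x \<otimes> e)" for y A
      by (auto simp: l_coset_def)
    have u: "inv x \<in> carrier K" "x \<otimes> inv x = \<one>" "x \<in> carrier K"
      using x by (auto simp: field_Units)
    have eq: "s \<otimes> y \<in> x <#\<^bsub>K\<^esub> E \<longleftrightarrow> s \<otimes> (inv x \<otimes> y) \<in> E"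
      if "s \<in> D" "y \<in> carrier K" for s y
    proof
      assume "s \<otimes> y \<in> x <#\<^bsub>K\<^esub> E"
      then obtain e where e: "e \<in> E" "s \<otimes> y = x \<otimes> e"
        by (auto simp: mem)
      have "s \<otimes> (inv x \<otimes> y) = inv x \<otimes> (x \<otimes> e)"
        using that u e(1) by (simp flip: e(2) add: m_lcomm)
      also have "\<dots> = (x \<otimes> inv x) \<otimes> e"
        using u(1,3) e by (simp add: m_ac)
      finally show "s \<otimes> (inv x \<otimes> y) \<in> E"
        using e u by simp
    next
      assume a: "s \<otimes> (inv x \<otimes> y) \<in> E"
      have "x \<otimes> (s \<otimes> (inv x \<otimes> y)) = (x \<otimes> inv x) \<otimes> (s \<otimes> y)"
        using u(1,3) that by (simp add: m_ac)
      then show "s \<otimes> y \<in> x <#\<^bsub>K\<^esub> E"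
        using a u that by (auto simp: mem intro!: bexI[of _ "s \<otimes> (inv x \<otimes> y)"])
    qed
    have scaled: "y \<in> x <#\<^bsub>K\<^esub> spectral K D Y E \<longleftrightarrow>
        y \<in> carrier K \<and> inv x \<otimes> y \<in> spectral K D Y E" for y
    proof
      assume "y \<in> x <#\<^bsub>K\<^esub> spectral K D Y E"
      then obtain e where e: "e \<in> spectral K D Y E" "y = x \<otimes> e"
        by (auto simp: mem)
      then have c: "e \<in> carrier K"
        by (simp add: spectral_def)
      have "inv x \<otimes> y = (x \<otimes> inv x) \<otimes> e"
        using u(1,3) e c by (simp add: m_ac)
      then show "y \<in> carrier K \<and> inv x \<otimes> y \<in> spectral K D Y E"
        using e u c by simp
    next
      assume y: "y \<in> carrier K \<and> inv x \<otimes> y \<in> spectral K D Y E"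
      then have "x \<otimes> (inv x \<otimes> y) = y"
        using u by (simp flip: m_assoc)
      then show "y \<in> x <#\<^bsub>K\<^esub> spectral K D Y E"
        using y by (auto simp: mem intro!: bexI[of _ "inv x \<otimes> y"])
    qed
    show ?thesis
    proof (rule Set.set_eqI)
      fix y
      show "y \<in> spectral K D Y (x <#\<^bsub>K\<^esub> E) \<longleftrightarrow> y \<in> x <#\<^bsub>K\<^esub> spectral K D Y E"
        unfolding iff[OF scaled_submodule[OF E x]] scaled iff[OF E]
        using eq[of _ y] m_closed[OF u(1), of y] by (meson DiffD1)
    qed
  qed
  show ?thesis
    unfolding semistar_operation_def
    by (intro conjI ballI impI Pi_I) (simp_all only: ext closed mono idem hom)
qed

end

end

theory Submission
  imports Defs
begin

text \<open>
  An element \<open>x\<close> lies in the tilde closure of \<open>E\<close> for the spectral operation of \<open>Y\<close> iff some nonzero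
  finitely generated ideal \<open>J\<close>, contained in no member of \<open>Y\<close>, satisfies \<open>x J \<subseteq> E\<close>. Hence the two
  operations attached to \<open>\<nabla>(P)\<close> and \<open>\<Delta>(P)\<close> differ iff there is such a \<open>J\<close> for \<open>\<nabla>(P)\<close> with
  \<open>J \<subseteq> P\<close>. In a Pruefer domain the inverse of such a \<open>J\<close> lies in \<open>\<Theta>(P)\<close>, but not in \<open>D\<^sub>P\<close> because
  \<open>1 \<in> J J\<^sup>-\<^sup>1\<close>. Conversely, for \<open>x\<close> in \<open>\<Theta>(P)\<close> and not in \<open>D\<^sub>P\<close>, the conductor \<open>(D : (1, x))\<close> is
  invertible, hence finitely generated; it is contained in \<open>P\<close> and in no member of \<open>\<nabla>(P)\<close>.
\<close>

lemma semistar_less_iff: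
  assumes "semistar_le K D star1 star2"
  shows "semistar_less K D star1 star2 \<longleftrightarrow>
    (\<exists>E\<in>submodules K D. \<exists>x. x \<in> star2 E \<and> x \<notin> star1 E)"
  using assms unfolding semistar_less_def semistar_le_def by blast

section \<open>Ideals and prime ideals of \<open>D\<close> as \<open>D\<close>-submodules of
  \<open>K\<close>\<close>

context quotient_field
begin

lemma D_mem_carrier [simp]: "a \<in> D \<Longrightarrow> a \<in> carrier K"
  using D_carrier by blast

lemma ideal_sub_ring_iff:
  "ideal I (sub_ring K D) \<longleftrightarrow> I \<subseteq> D \<and> submodule I (sub_ring K D) (self_module K)"
proof
  assume "ideal I (sub_ring K D)"
  then interpret I: ideal I "sub_ring K D" .
  show "I \<subseteq> D \<and> submodule I (sub_ring K D) (self_module K)"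
    using I.a_subset I.I_l_closed additive_subgroup.zero_closed[OF I.is_additive_subgroup]
      additive_subgroup.a_closed[OF I.is_additive_subgroup] D_carrier
    by (auto simp: submodule_iff)
next
  assume R: "I \<subseteq> D \<and> submodule I (sub_ring K D) (self_module K)"
  interpret D: domain "sub_ring K D"
    by (rule D_domain)
  note I = conjunct1[OF R] conjunct2[OF R, unfolded submodule_iff]
  \<comment> \<open>Negation here is that of \<open>sub_ring K D\<close>. Writing it as
    multiplication by minus one, an element of \<open>D\<close>, reduces it to closure under
    scalars.\<close>
  have neg: "\<ominus>\<^bsub>sub_ring K D\<^esub> x \<in> I" if "x \<in> I" for x
  proof -
    have x: "x \<in> carrier (sub_ring K D)"
      using that I by auto
    have "\<ominus>\<^bsub>sub_ring K D\<^esub> x = (\<ominus>\<^bsub>sub_ring K D\<^esub> \<one>\<^bsub>sub_ring K D\<^esub>) \<otimes>\<^bsub>sub_ring K D\<^esub> x"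
      using x D.l_minus[OF D.one_closed x] D.l_one[OF x] by simp
    moreover have "\<ominus>\<^bsub>sub_ring K D\<^esub> \<one>\<^bsub>sub_ring K D\<^esub> \<in> D"
      using D.a_inv_closed[OF D.one_closed] by simp
    ultimately show ?thesis
      using I that by simp
  qed
  show "ideal I (sub_ring K D)"
  proof (rule idealI)
    show "ring (sub_ring K D)"
      by (rule D.ring_axioms)
    show "subgroup I (add_monoid (sub_ring K D))"
      using I neg by (intro D.add.subgroupI) auto
    fix a x assume a: "a \<in> I" and x: "x \<in> carrier (sub_ring K D)"
    then show "x \<otimes>\<^bsub>sub_ring K D\<^esub> a \<in> I"
      using I by auto
    have "a \<otimes> x = x \<otimes> a"
      using a x I by (intro m_comm) auto
    then show "a \<otimes>\<^bsub>sub_ring K D\<^esub> x \<in> I"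
      using a x I by auto
  qed
qed

lemma nonzero_ideal_iff:
  "ideal I (sub_ring K D) \<and> I \<noteq> {\<zero>} \<longleftrightarrow> I \<in> submodules K D \<and> I \<subseteq> D"
  by (auto simp: ideal_sub_ring_iff submodules_def)

lemma SpecD:
  assumes "Q \<in> Spec K D"
  shows "Q \<subseteq> D" "submodule Q (sub_ring K D) (self_module K)"
  using assms ideal_sub_ring_iff by (auto simp: Spec_def primeideal_def)

lemma SpecI:
  assumes I: "I \<in> submodules K D" "I \<subseteq> D" "\<one> \<notin> I"
    and prime: "\<And>a b. a \<in> D \<Longrightarrow> b \<in> D \<Longrightarrow> a \<otimes> b \<in> I \<Longrightarrow> a \<in> I \<or> b \<in> I"
  shows "I \<in> Spec K D"
proof -
  have "primeideal I (sub_ring K D)"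
  proof (rule primeidealI)
    show "ideal I (sub_ring K D)"
      using I nonzero_ideal_iff by blast
    show "cring (sub_ring K D)"
      using D_domain by (simp add: domain_def)
    show "carrier (sub_ring K D) \<noteq> I"
      using I subringE(3)[OF D_subring] by auto
  qed (use prime in auto)
  then show ?thesis
    by (simp add: Spec_def)
qed

lemma MaxSpec_subset_Spec: "MaxSpec K D \<subseteq> Spec K D"
proof -
  have "cring (sub_ring K D)"
    using D_domain by (simp add: domain_def)
  then show ?thesis
    unfolding MaxSpec_def Spec_def using cring.maximalideal_prime by blast
qed

section \<open>Finitely generated submodules of \<open>K\<close>\<close>

definition generated :: "'a set \<Rightarrow> 'a set"
  where "generated S = \<Inter>{E. submodule E (sub_ring K D) (self_module K) \<and> S \<subseteq> E}"

lemma generated_superset: "S \<subseteq> generated S"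
  by (auto simp: generated_def)

lemma generated_minimal:
  "submodule E (sub_ring K D) (self_module K) \<Longrightarrow> S \<subseteq> E \<Longrightarrow> generated S \<subseteq> E"
  by (auto simp: generated_def)

lemma submodule_generated:
  assumes "S \<subseteq> carrier K"
  shows "submodule (generated S) (sub_ring K D) (self_module K)"
proof -
  \<comment> \<open>The whole field belongs to the family that is intersected, so the intersection
    stays inside \<open>carrier K\<close>.\<close>
  have "submodule (carrier K) (sub_ring K D) (self_module K)"
    by (auto simp: submodule_iff)
  then have "generated S \<subseteq> carrier K"
    using assms by (rule generated_minimal)
  then show ?thesis
    unfolding submodule_iff by (auto simp: generated_def submodule_iff)
qed

lemma generated_mono: "S \<subseteq> T \<Longrightarrow> generated S \<subseteq> generated T"
  by (auto simp: generated_def)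

lemma generated_in_submodules:
  "S \<subseteq> carrier K \<Longrightarrow> \<not> S \<subseteq> {\<zero>} \<Longrightarrow> generated S \<in> submodules K D"
  using submodule_generated[of S] generated_superset[of S] by (auto simp: submodules_def)

text \<open>A set inside \<open>{\<zero>}\<close> generates the zero submodule, so the nonzero
  condition on \<open>F\<close> becomes a condition on its generators, which survives unions of
  generating sets.\<close>

lemma fg_submodules_iff:
  "F \<in> fg_submodules K D \<longleftrightarrow>
    (\<exists>S. finite S \<and> S \<subseteq> carrier K \<and> \<not> S \<subseteq> {\<zero>} \<and> F = generated S)"
proof
  assume "F \<in> fg_submodules K D"
  then obtain S where S: "F \<in> submodules K D" "finite S" "S \<subseteq> carrier K" "F = generated S"
    by (auto simp: fg_submodules_def generated_def)
  have "submodule {\<zero>} (sub_ring K D) (self_module K)"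
    by (auto simp: submodule_iff)
  then have "\<not> S \<subseteq> {\<zero>}"
    using generated_minimal[of "{\<zero>}" S] S by (auto simp: submodules_iff)
  then show "\<exists>S. finite S \<and> S \<subseteq> carrier K \<and> \<not> S \<subseteq> {\<zero>} \<and> F = generated S"
    using S by blast
next
  assume "\<exists>S. finite S \<and> S \<subseteq> carrier K \<and> \<not> S \<subseteq> {\<zero>} \<and> F = generated S"
  then show "F \<in> fg_submodules K D"
    using generated_in_submodules by (auto simp: fg_submodules_def generated_def)
qed

section \<open>Dense ideals and finite-type operations\<close>

text \<open>
  The ideals that are dense for \<open>Y\<close> form the localizing system of finite type whose
  semistar operation is the tilde of \<^term>\<open>spectral K D Y\<close>.
\<close>

definition dense :: "'a set set \<Rightarrow> 'a set \<Rightarrow> bool"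
  where "dense Y I \<longleftrightarrow> (\<exists>S. finite S \<and> S \<subseteq> I \<and> \<not> S \<subseteq> {\<zero>} \<and> (\<forall>Q\<in>Y. \<not> S \<subseteq> Q))"

lemma dense_mono: "dense Y I \<Longrightarrow> I \<subseteq> J \<Longrightarrow> dense Y J"
  unfolding dense_def by (meson order_trans)

lemma dense_antimono: "dense Z I \<Longrightarrow> Y \<subseteq> Z \<Longrightarrow> dense Y I"
  unfolding dense_def by blast

lemma dense_if_one:
  assumes "Y \<subseteq> Spec K D" "\<one> \<in> I"
  shows "dense Y I"
  unfolding dense_def
  using assms prime_complement(1) by (intro exI[of _ "{\<one>}"]) auto

text \<open>The union that defines \<open>finite_type\<close> is directed: the submodules generated
  by \<open>T\<close> and by \<open>U\<close> both lie in the one generated by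
  \<open>T \<union> U\<close>. A finite set is therefore captured by a single member of the
  union.\<close>

lemma finite_type_finite_subset:
  assumes mono: "\<And>E F. E \<in> submodules K D \<Longrightarrow> F \<in> submodules K D \<Longrightarrow> E \<subseteq> F \<Longrightarrow> star E \<subseteq> star F"
    and I: "I \<in> submodules K D" and S: "finite S" "S \<subseteq> finite_type K D star I"
  obtains T where "finite T" "T \<subseteq> I" "\<not> T \<subseteq> {\<zero>}" "S \<subseteq> star (generated T)"
proof -
  have Ic: "I \<subseteq> carrier K"
    using I by (auto simp: submodules_iff)
  have "\<exists>T. finite T \<and> T \<subseteq> I \<and> \<not> T \<subseteq> {\<zero>} \<and> S \<subseteq> star (generated T)"
    using S
  proof (induction S)
    case empty
    \<comment> \<open>Nothing has to be covered, but \<open>T\<close> must still have a nonzero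
      element.\<close>
    obtain e where "e \<in> I" "e \<noteq> \<zero>"
      using I by (auto simp: submodules_iff)
    then show ?case
      by (intro exI[of _ "{e}"]) auto
  next
    case (insert x S)
    then obtain T where T: "finite T" "T \<subseteq> I" "\<not> T \<subseteq> {\<zero>}" "S \<subseteq> star (generated T)"
      by auto
    obtain F where F: "F \<in> fg_submodules K D" "F \<subseteq> I" "x \<in> star F"
      using insert.prems by (auto simp: finite_type_def)
    then obtain U where U: "finite U" "\<not> U \<subseteq> {\<zero>}" "F = generated U"
      by (auto simp: fg_submodules_iff)
    then have UI: "U \<subseteq> I"
      using F generated_superset by blast
    have "generated T \<in> submodules K D" "generated U \<in> submodules K D" "generated (T \<union> U) \<in> submodules K D"
      using T U UI Ic by (auto intro!: generated_in_submodules)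
    then have "star (generated T) \<subseteq> star (generated (T \<union> U))" "star (generated U) \<subseteq> star (generated (T \<union> U))"
      using mono generated_mono by (meson Un_upper1 Un_upper2)+
    then show ?case
      using T U UI F by (intro exI[of _ "T \<union> U"]) auto
  qed
  then show ?thesis
    using that by blast
qed

lemma finite_type_superset:
  assumes ext: "\<And>E. E \<in> submodules K D \<Longrightarrow> E \<subseteq> star E"
    and I: "I \<in> submodules K D"
  shows "I \<subseteq> finite_type K D star I"
proof
  fix x assume x: "x \<in> I"
  \<comment> \<open>Since \<open>x\<close> may be zero, a nonzero \<open>e\<close> is added to make
    the generated submodule nonzero.\<close>
  obtain e where e: "e \<in> I" "e \<noteq> \<zero>"
    using I by (auto simp: submodules_iff)
  have sub: "{e, x} \<subseteq> carrier K" "\<not> {e, x} \<subseteq> {\<zero>}" "submodule I (sub_ring K D) (self_module K)"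
    using I x e by (auto simp: submodules_def submodule_iff)
  have "generated {e, x} \<in> fg_submodules K D"
    unfolding fg_submodules_iff using sub by (intro exI[of _ "{e, x}"]) simp
  moreover have "generated {e, x} \<subseteq> I"
    using sub(3) x e by (intro generated_minimal) auto
  moreover have "x \<in> star (generated {e, x})"
    using ext[OF generated_in_submodules[OF sub(1,2)]] generated_superset[of "{e, x}"] by auto
  ultimately show "x \<in> finite_type K D star I"
    by (auto simp: finite_type_def)
qed

lemma spectral_semistar:
  assumes Y: "Y \<subseteq> Spec K D" and E: "E \<in> submodules K D"
  shows "E \<subseteq> spectral K D Y E" "spectral K D Y E \<in> submodules K D"
    "F \<in> submodules K D \<Longrightarrow> E \<subseteq> F \<Longrightarrow> spectral K D Y E \<subseteq> spectral K D Y F"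
  using semistar_operation_spectral[OF Y] E by (auto simp: semistar_operation_def)

section \<open>The finite-type operation of a spectral operation\<close>

context
  fixes Y :: "'a set set"
  assumes Y: "Y \<subseteq> Spec K D"
begin

abbreviation ft :: "'a set \<Rightarrow> 'a set"
  where "ft \<equiv> finite_type K D (spectral K D Y)"

lemma ft_finite_subset:
  assumes "I \<in> submodules K D" "finite S" "S \<subseteq> ft I"
  obtains T where "finite T" "T \<subseteq> I" "\<not> T \<subseteq> {\<zero>}" "S \<subseteq> spectral K D Y (generated T)"
  using finite_type_finite_subset[of "spectral K D Y" I S] spectral_semistar(3)[OF Y] assms
  by blast

lemma spectral_generated_subset_ft:
  assumes "I \<in> submodules K D" "finite T" "T \<subseteq> I" "\<not> T \<subseteq> {\<zero>}"
  shows "spectral K D Y (generated T) \<subseteq> ft I"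
proof -
  have "submodule I (sub_ring K D) (self_module K)" "T \<subseteq> carrier K"
    using assms by (auto simp: submodules_iff submodules_def submodule_iff)
  then have "generated T \<in> fg_submodules K D" "generated T \<subseteq> I"
    using assms generated_minimal[of I T] fg_submodules_iff[of "generated T"] by auto
  then show ?thesis
    by (auto simp: finite_type_def)
qed

lemma ft_superset: "I \<in> submodules K D \<Longrightarrow> I \<subseteq> ft I"
  by (rule finite_type_superset[of "spectral K D Y"]) (rule spectral_semistar(1)[OF Y])

lemma ft_in_submodules:
  assumes I: "I \<in> submodules K D"
  shows "ft I \<in> submodules K D"
proof -
  have closed: "x \<oplus> y \<in> ft I \<and> (\<forall>a\<in>D. a \<otimes> x \<in> ft I) \<and> x \<in> carrier K"
    if xy: "x \<in> ft I" "y \<in> ft I" for x y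
  proof -
    \<comment> \<open>Both elements lie in the closure of one generated submodule. That closure is a
      submodule contained in \<open>ft I\<close>, so sums and multiples stay in
      \<open>ft I\<close>.\<close>
    obtain T where T: "finite T" "T \<subseteq> I" "\<not> T \<subseteq> {\<zero>}" "{x, y} \<subseteq> spectral K D Y (generated T)"
      using ft_finite_subset[OF I, of "{x, y}"] xy by auto
    then have "generated T \<in> submodules K D"
      using I by (intro generated_in_submodules) (auto simp: submodules_iff)
    then have "spectral K D Y (generated T) \<in> submodules K D"
      using spectral_semistar(2)[OF Y] by blast
    then show ?thesis
      using T(4) spectral_generated_subset_ft[OF I T(1-3)] by (auto simp: submodules_iff)
  qed
  then have "ft I \<subseteq> carrier K" "\<forall>x\<in>ft I. \<forall>y\<in>ft I. x \<oplus> y \<in> ft I" "\<forall>a\<in>D. \<forall>x\<in>ft I. a \<otimes> x \<in> ft I"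
    by (meson subsetI)+
  moreover have "\<zero> \<in> ft I" "ft I \<noteq> {\<zero>}"
    using ft_superset[OF I] I by (auto simp: submodules_iff)
  ultimately show ?thesis
    by (simp add: submodules_iff)
qed

lemma ft_Int_D:
  assumes I: "I \<in> submodules K D" "I \<subseteq> D"
  shows "I \<subseteq> ft I \<inter> D" "ft I \<inter> D \<in> submodules K D"
proof -
  show "I \<subseteq> ft I \<inter> D"
    using ft_superset I by blast
  then show "ft I \<inter> D \<in> submodules K D"
    using I(1) ft_in_submodules[OF I(1)] D_subring
    by (auto simp: submodules_iff subringE(2,6,7))
qed

text \<open>The finite witness \<open>S\<close> lies in the closure of some
  \<open>generated T\<close> with \<open>T\<close> a finite subset of \<open>I\<close>, and
  \<open>T\<close> is the new witness: if \<open>T\<close> were inside a prime \<open>Q\<close> of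
  \<open>Y\<close>, each \<open>s\<close> in \<open>S\<close> would have a multiple
  \<open>t \<otimes> s\<close> in \<open>Q\<close> with \<open>t\<close> outside \<open>Q\<close>,
  forcing \<open>S\<close> into \<open>Q\<close>.\<close>

lemma dense_ft:
  assumes I: "I \<in> submodules K D" and dense: "dense Y (ft I \<inter> D)"
  shows "dense Y I"
proof -
  obtain S where S: "finite S" "S \<subseteq> ft I" "S \<subseteq> D" "\<forall>Q\<in>Y. \<not> S \<subseteq> Q"
    using dense unfolding dense_def by blast
  obtain T where T: "finite T" "T \<subseteq> I" "\<not> T \<subseteq> {\<zero>}" "S \<subseteq> spectral K D Y (generated T)"
    using ft_finite_subset[OF I S(1,2)] by blast
  have gen: "generated T \<in> submodules K D"
    using T I by (intro generated_in_submodules) (auto simp: submodules_iff)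
  have "\<not> T \<subseteq> Q" if Q: "Q \<in> Y" for Q
  proof
    assume "T \<subseteq> Q"
    then have TQ: "generated T \<subseteq> Q"
      using SpecD(2) Q Y by (intro generated_minimal) auto
    obtain s where s: "s \<in> S" "s \<notin> Q"
      using S Q by blast
    then obtain t where t: "t \<in> D - Q" "t \<otimes> s \<in> generated T"
      using T(4) Q spectral_iff[OF Y gen] by blast
    then show False
      using prime_complement(3)[of Q t s] TQ Q Y s S by blast
  qed
  then show ?thesis
    using T unfolding dense_def by blast
qed

text \<open>For each \<open>Q\<close> in \<open>Y\<close> the witness \<open>S\<close> of density
  has an element outside \<open>Q\<close>, which serves as a denominator for \<open>\<one>\<close>.
  So \<open>\<one>\<close> is in the spectral closure of \<open>generated S\<close>.\<close>

lemma one_in_ft: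
  assumes I: "I \<in> submodules K D" "I \<subseteq> D" and dense: "dense Y I"
  shows "\<one> \<in> ft I"
proof -
  obtain S where S: "finite S" "S \<subseteq> I" "\<not> S \<subseteq> {\<zero>}" "\<forall>Q\<in>Y. \<not> S \<subseteq> Q"
    using dense unfolding dense_def by blast
  have gen: "generated S \<in> submodules K D"
    using S I by (intro generated_in_submodules) (auto simp: submodules_iff)
  have "\<exists>s\<in>D - Q. s \<otimes> \<one> \<in> generated S" if Q: "Q \<in> Y" for Q
  proof -
    obtain s where s: "s \<in> S" "s \<in> D - Q"
      using S I Q by blast
    then have "s \<otimes> \<one> = s"
      by simp
    then show ?thesis
      using s generated_superset by fastforce
  qed
  then have "\<one> \<in> spectral K D Y (generated S)"
    by (simp add: spectral_iff[OF Y gen])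
  then show ?thesis
    using spectral_generated_subset_ft[OF I(1) S(1-3)] by blast
qed

lemma quasi_star_ideal_iff:
  "quasi_star_ideal K D star J \<longleftrightarrow> J \<in> submodules K D \<and> J \<subseteq> D \<and> star J \<inter> D = J"
  using nonzero_ideal_iff[of J] by (auto simp: quasi_star_ideal_def)

text \<open>Density would put \<open>\<one>\<close> into \<open>ft J \<inter> D\<close>, which
  equals \<open>J\<close>.\<close>

lemma quasi_ft_ideal_not_dense:
  assumes "quasi_star_ideal K D ft J" "J \<noteq> D"
  shows "\<not> dense Y J"
proof
  assume "dense Y J"
  then have "\<one> \<in> J"
    using one_in_ft assms(1) subringE(3)[OF D_subring] by (auto simp: quasi_star_ideal_iff)
  then have "a \<in> J" if "a \<in> D" for a
    using that assms(1) r_one[of a] by (force simp: quasi_star_ideal_iff submodules_iff)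
  then show False
    using assms by (auto simp: quasi_star_ideal_iff)
qed

section \<open>Maximal nondense ideals: existence, identification with \<open>QMax\<close>,
  primality\<close>

text \<open>
  \<^term>\<open>ft Q \<inter> D\<close> is again a nondense ideal, so a maximal nondense ideal \<^term>\<open>Q\<close> equals it.
\<close>

lemma maximal_nondense_in_QMax:
  assumes Q: "Q \<in> submodules K D" "Q \<subseteq> D" "\<not> dense Y Q"
    and max: "\<And>J. J \<in> submodules K D \<Longrightarrow> J \<subseteq> D \<Longrightarrow> \<not> dense Y J \<Longrightarrow> Q \<subseteq> J \<Longrightarrow> J = Q"
  shows "Q \<in> QMax K D ft"
proof -
  have "ft Q \<inter> D = Q"
    using max[of "ft Q \<inter> D"] ft_Int_D[OF Q(1,2)] dense_ft[OF Q(1)] Q(3) by blast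
  moreover have "Q \<noteq> D"
    using dense_if_one[OF Y subringE(3)[OF D_subring]] Q(3) by blast
  ultimately show ?thesis
    unfolding QMax_def using Q max quasi_ft_ideal_not_dense by (auto simp: quasi_star_ideal_iff)
qed

text \<open>Zorn's lemma applies to the nondense ideals above \<open>I\<close>, because a witness of
  density is finite: if it lies in the union of a chain, it already lies in one member.\<close>

lemma nondense_subset_QMax:
  assumes I: "I \<in> submodules K D" "I \<subseteq> D" "\<not> dense Y I"
  obtains Q where "Q \<in> QMax K D ft" "I \<subseteq> Q"
proof -
  define A where "A = {J \<in> submodules K D. J \<subseteq> D \<and> \<not> dense Y J \<and> I \<subseteq> J}"
  have "\<exists>Q\<in>A. \<forall>J\<in>A. Q \<subseteq> J \<longrightarrow> J = Q"
  proof (rule subset_Zorn_nonempty)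
    show "A \<noteq> {}"
      using I by (auto simp: A_def)
    fix C assume C: "C \<noteq> {}" "subset.chain A C"
    then have CA: "C \<subseteq> A" and dir: "\<And>J L. J \<in> C \<Longrightarrow> L \<in> C \<Longrightarrow> J \<subseteq> L \<or> L \<subseteq> J"
      by (auto simp: subset_chain_def)
    have IC: "I \<subseteq> \<Union>C"
      using C CA by (auto simp: A_def)
    have plus: "x \<oplus> y \<in> \<Union>C" if "x \<in> J" "y \<in> L" "J \<in> C" "L \<in> C" for x y J L
    proof -
      have "\<exists>N\<in>C. x \<in> N \<and> y \<in> N"
        using dir[OF that(3,4)] that by (elim disjE) (meson subsetD)+
      then obtain N where N: "N \<in> C" "x \<in> N" "y \<in> N"
        by blast
      then have "N \<in> submodules K D"
        using CA by (auto simp: A_def)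
      then have "x \<oplus> y \<in> N"
        using N by (simp add: submodules_iff)
      then show ?thesis
        using N(1) by blast
    qed
    have "\<Union>C \<in> submodules K D"
      unfolding submodules_iff
    proof (intro conjI ballI)
      show "\<Union>C \<noteq> {\<zero>}"
        using IC I(1) by (auto simp: submodules_iff)
      show "\<Union>C \<subseteq> carrier K"
        using CA by (auto simp: A_def submodules_iff)
      show "\<zero> \<in> \<Union>C"
        using IC I(1) by (auto simp: submodules_iff)
      show "x \<oplus> y \<in> \<Union>C" if "x \<in> \<Union>C" "y \<in> \<Union>C" for x y
        using that plus by blast
      show "a \<otimes> x \<in> \<Union>C" if "a \<in> D" "x \<in> \<Union>C" for a x
        using that CA by (fastforce simp: A_def submodules_iff)
    qed
    moreover have "\<not> dense Y (\<Union>C)"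
    proof
      assume "dense Y (\<Union>C)"
      then obtain S where S: "finite S" "S \<subseteq> \<Union>C" "\<not> S \<subseteq> {\<zero>}" "\<forall>Q\<in>Y. \<not> S \<subseteq> Q"
        unfolding dense_def by blast
      obtain J where "J \<in> C" "S \<subseteq> J"
        using finite_subset_Union_chain[OF S(1,2) C] by blast
      then show False
        using S CA unfolding A_def dense_def by blast
    qed
    ultimately show "\<Union>C \<in> A"
      using CA IC by (auto simp: A_def)
  qed
  then obtain Q where "Q \<in> A" "\<And>J. J \<in> A \<Longrightarrow> Q \<subseteq> J \<Longrightarrow> J = Q"
    by blast
  \<comment> \<open>A nondense ideal above \<open>Q\<close> also contains \<open>I\<close>, so
    maximality in \<open>A\<close> is maximality among all nondense ideals.\<close>
  then show ?thesis
    using that maximal_nondense_in_QMax[of Q] unfolding A_def by blast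
qed

text \<open>The ideal \<open>I + D a\<close> is what enlarges a maximal nondense ideal in the proof
  that such an ideal is prime.\<close>

lemma add_principal_ideal:
  assumes I: "I \<in> submodules K D" "I \<subseteq> D" and a: "a \<in> D"
  defines "J \<equiv> {i \<oplus> d \<otimes> a | i d. i \<in> I \<and> d \<in> D}"
  shows "J \<in> submodules K D" "J \<subseteq> D" "I \<subseteq> J" "a \<in> J"
proof -
  have zero: "\<zero> \<in> I"
    using I by (auto simp: submodules_iff)
  show IJ: "I \<subseteq> J"
  proof
    fix i assume i: "i \<in> I"
    then have "i = i \<oplus> \<zero> \<otimes> a"
      using I a by auto
    then show "i \<in> J"
      using i subringE(2)[OF D_subring] unfolding J_def by blast
  qed
  have "a = \<zero> \<oplus> \<one> \<otimes> a"
    using a by simp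
  then show "a \<in> J"
    using zero subringE(3)[OF D_subring] unfolding J_def by blast
  show JD: "J \<subseteq> D"
    using I a subringE(6,7)[OF D_subring] by (auto simp: J_def)
  have "x \<oplus> y \<in> J" if xy: "x \<in> J" "y \<in> J" for x y
  proof -
    obtain i d where i: "x = i \<oplus> d \<otimes> a" "i \<in> I" "d \<in> D"
      using xy(1) by (auto simp: J_def)
    obtain j e where j: "y = j \<oplus> e \<otimes> a" "j \<in> I" "e \<in> D"
      using xy(2) by (auto simp: J_def)
    have "i \<in> carrier K" "j \<in> carrier K"
      using i j I by auto
    then have "x \<oplus> y = (i \<oplus> j) \<oplus> (d \<oplus> e) \<otimes> a" "i \<oplus> j \<in> I" "d \<oplus> e \<in> D"
      using i j I a subringE(7)[OF D_subring] by (auto simp: l_distr a_ac submodules_iff)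
    then show ?thesis
      unfolding J_def by blast
  qed
  moreover have "c \<otimes> x \<in> J" if cx: "c \<in> D" "x \<in> J" for c x
  proof -
    obtain i d where "x = i \<oplus> d \<otimes> a" "i \<in> I" "d \<in> D"
      using cx(2) by (auto simp: J_def)
    moreover from this have "i \<in> carrier K"
      using I by auto
    ultimately have "c \<otimes> x = c \<otimes> i \<oplus> (c \<otimes> d) \<otimes> a" "c \<otimes> i \<in> I" "c \<otimes> d \<in> D"
      using I a cx(1) subringE(6)[OF D_subring] by (auto simp: r_distr m_assoc submodules_iff)
    then show ?thesis
      unfolding J_def by blast
  qed
  moreover have "J \<noteq> {\<zero>}" "\<zero> \<in> J" "J \<subseteq> carrier K"
    using IJ JD I(1) D_carrier by (auto simp: submodules_iff)
  ultimately show "J \<in> submodules K D"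
    by (simp add: submodules_iff)
qed

text \<open>By definition \<open>Q\<close> is maximal only among proper quasi-ideals. A nondense
  \<open>J\<close> need not be one, but it lies below a member of \<open>QMax\<close>, which must
  then be \<open>Q\<close>.\<close>

lemma QMax_ft_maximal:
  assumes Q: "Q \<in> QMax K D ft"
    and J: "J \<in> submodules K D" "J \<subseteq> D" "\<not> dense Y J" "Q \<subseteq> J"
  shows "J = Q"
proof -
  obtain M where "M \<in> QMax K D ft" "J \<subseteq> M"
    using nondense_subset_QMax J(1-3) by blast
  then show ?thesis
    using Q J(4) unfolding QMax_def by blast
qed

lemma QMax_ft_not_dense: "Q \<in> QMax K D ft \<Longrightarrow> \<not> dense Y Q"
  using quasi_ft_ideal_not_dense by (auto simp: QMax_def)

text \<open>The usual argument for maximal elements: if \<open>a\<close> and \<open>b\<close> are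
  outside \<open>Q\<close>, then \<open>Q + D a\<close> and \<open>Q + D b\<close> are dense by
  maximality, and the products of their witnesses show that \<open>Q\<close> is dense.\<close>

lemma QMax_ft_subset_Spec: "QMax K D ft \<subseteq> Spec K D"
proof
  fix Q assume Q: "Q \<in> QMax K D ft"
  then have QD: "Q \<in> submodules K D" "Q \<subseteq> D"
    by (auto simp: QMax_def quasi_star_ideal_iff)
  show "Q \<in> Spec K D"
  proof (rule SpecI)
    show "\<one> \<notin> Q"
      using QMax_ft_not_dense[OF Q] dense_if_one[OF Y] by blast
    fix a b assume ab: "a \<in> D" "b \<in> D" "a \<otimes> b \<in> Q"
    show "a \<in> Q \<or> b \<in> Q"
    proof (rule ccontr)
      assume not: "\<not> (a \<in> Q \<or> b \<in> Q)"
      define J where "J c = {i \<oplus> d \<otimes> c | i d. i \<in> Q \<and> d \<in> D}" for c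
      note J = add_principal_ideal[OF QD, folded J_def]
      have dense_J: "dense Y (J c)" if c: "c \<in> D" "c \<notin> Q" for c
      proof (rule ccontr)
        assume "\<not> dense Y (J c)"
        then have "J c = Q"
          by (rule QMax_ft_maximal[OF Q J(1,2)[OF c(1)] _ J(3)[OF c(1)]])
        then show False
          using J(4)[OF c(1)] c(2) by simp
      qed
      obtain S where S: "finite S" "S \<subseteq> J a" "\<not> S \<subseteq> {\<zero>}" "\<forall>P\<in>Y. \<not> S \<subseteq> P"
        using dense_J[of a] ab not unfolding dense_def by blast
      obtain T where T: "finite T" "T \<subseteq> J b" "\<not> T \<subseteq> {\<zero>}" "\<forall>P\<in>Y. \<not> T \<subseteq> P"
        using dense_J[of b] ab not unfolding dense_def by blast
      have SD: "S \<subseteq> D" and TD: "T \<subseteq> D"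
        using S(2) T(2) J(2) ab by blast+
      \<comment> \<open>\<open>U\<close> is finite and nonzero since \<open>K\<close> has no zero
        divisors, and it escapes every prime of \<open>Y\<close> since \<open>S\<close> and
        \<open>T\<close> do.\<close>
      define U where "U = (\<lambda>(s, t). s \<otimes> t) ` (S \<times> T)"
      have "s \<otimes> t \<in> Q" if st: "s \<in> S" "t \<in> T" for s t
      proof -
        obtain i d where i: "s = i \<oplus> d \<otimes> a" "i \<in> Q" "d \<in> D"
          using S(2) st(1) by (auto simp: J_def)
        obtain j e where j: "t = j \<oplus> e \<otimes> b" "j \<in> Q" "e \<in> D"
          using T(2) st(2) by (auto simp: J_def)
        have [simp]: "i \<in> carrier K" "j \<in> carrier K" "a \<in> carrier K" "b \<in> carrier K"
            "d \<in> carrier K" "e \<in> carrier K"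
          using i j QD ab by auto
        \<comment> \<open>The three summands carry the factors \<open>i\<close>, \<open>j\<close>
          and \<open>a \<otimes> b\<close>, all of which lie in \<open>Q\<close>.\<close>
        have "s \<otimes> t = t \<otimes> i \<oplus> ((d \<otimes> a) \<otimes> j \<oplus> (d \<otimes> e) \<otimes> (a \<otimes> b))"
          unfolding i(1) j(1) by (simp add: l_distr r_distr m_ac a_ac)
        moreover have "t \<in> D" "d \<otimes> a \<in> D" "d \<otimes> e \<in> D"
          using TD st i j ab subringE(6)[OF D_subring] by auto
        ultimately show ?thesis
          using QD(1) i j ab by (auto simp: submodules_iff)
      qed
      then have "U \<subseteq> Q"
        by (auto simp: U_def)
      moreover have "finite U"
        using S T by (simp add: U_def)
      moreover have "\<not> U \<subseteq> {\<zero>}"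
      proof -
        obtain s t where "s \<in> S" "s \<noteq> \<zero>" "t \<in> T" "t \<noteq> \<zero>"
          using S T by blast
        moreover from this have "s \<in> carrier K" "t \<in> carrier K"
          using SD TD by auto
        ultimately have "s \<in> S" "t \<in> T" "s \<otimes> t \<noteq> \<zero>"
          by (simp_all add: integral_iff)
        then show ?thesis
          by (auto simp: U_def)
      qed
      moreover have "\<not> U \<subseteq> P" if "P \<in> Y" for P
      proof -
        obtain s t where "s \<in> S" "s \<notin> P" "t \<in> T" "t \<notin> P"
          using S T \<open>P \<in> Y\<close> by blast
        moreover from this have "s \<otimes> t \<notin> P"
          using SD TD prime_complement(3)[of P s t] Y \<open>P \<in> Y\<close> by auto
        ultimately show ?thesis
          by (auto simp: U_def)
      qed
      ultimately show False
        using QMax_ft_not_dense[OF Q] unfolding dense_def by blast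
    qed
  qed (use QD in auto)
qed

section \<open>Tilde closures described by conductors\<close>

lemma conductor_in_submodules:
  assumes E: "E \<in> submodules K D" and x: "x \<in> carrier K"
  shows "{d \<in> D. d \<otimes> x \<in> E} \<in> submodules K D"
proof -
  have "\<exists>d\<in>D. d \<otimes> x \<in> E \<and> d \<noteq> \<zero>"
  proof (cases "x = \<zero>")
    case True
    then show ?thesis
      using E subringE(3)[OF D_subring] by (auto simp: submodules_iff intro!: bexI[of _ \<one>])
  next
    case False
    \<comment> \<open>A nonzero conductor element comes from writing \<open>x / e\<close> as a
      fraction \<open>a / b\<close> over \<open>D\<close>: then \<open>b x = a e\<close> is in
      \<open>E\<close>.\<close>
    obtain e where e: "e \<in> E" "e \<noteq> \<zero>" "e \<in> carrier K"
      using E by (auto simp: submodules_iff)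
    have u: "inv e \<in> carrier K" "e \<otimes> inv e = \<one>"
      using e by (auto simp: field_Units)
    obtain a b where ab: "a \<in> D" "b \<in> D - {\<zero>}" "inv e \<otimes> x = a \<otimes> inv b"
      using fraction[of "inv e \<otimes> x"] u x by auto
    have v: "inv b \<in> carrier K" "b \<otimes> inv b = \<one>"
      using ab by (auto simp: field_Units)
    have "b \<otimes> x = b \<otimes> ((e \<otimes> inv e) \<otimes> x)"
      using u x by simp
    also have "\<dots> = b \<otimes> e \<otimes> (inv e \<otimes> x)"
      using u(1) x e(3) ab(1,2) by (simp add: m_assoc)
    also have "\<dots> = a \<otimes> e \<otimes> (b \<otimes> inv b)"
      unfolding ab(3) using u(1) v(1) x e(3) ab(1,2) by (simp add: m_ac)
    also have "\<dots> \<in> E"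
      using v e ab E by (simp add: submodules_iff)
    finally show ?thesis
      using ab by blast
  qed
  then show ?thesis
    using E x subringE(2,6,7)[OF D_subring]
    by (auto simp: submodules_iff l_distr m_assoc)
qed

text \<open>Membership says that the conductor of \<open>x\<close> into \<open>E\<close> lies in no
  member of \<open>QMax\<close>. This is density, since members of \<open>QMax\<close> are nondense
  and every nondense nonzero ideal lies in one of them.\<close>

proposition tilde_spectral_iff:
  assumes E: "E \<in> submodules K D"
  shows "x \<in> tilde K D (spectral K D Y) E \<longleftrightarrow> x \<in> carrier K \<and> dense Y {d \<in> D. d \<otimes> x \<in> E}"
proof -
  have "(\<forall>Q\<in>QMax K D ft. \<exists>s\<in>D - Q. s \<otimes> x \<in> E) \<longleftrightarrow> dense Y {d \<in> D. d \<otimes> x \<in> E}"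
    (is "?L \<longleftrightarrow> dense Y ?I") if "x \<in> carrier K"
  proof
    assume ?L
    then have "\<not> ?I \<subseteq> Q" if "Q \<in> QMax K D ft" for Q
      using that by blast
    then show "dense Y ?I"
      using nondense_subset_QMax[OF conductor_in_submodules[OF E \<open>x \<in> carrier K\<close>]] by blast
  next
    assume "dense Y ?I"
    then have "\<not> ?I \<subseteq> Q" if "Q \<in> QMax K D ft" for Q
      using that QMax_ft_not_dense dense_mono by blast
    then show ?L
      by blast
  qed
  then show ?thesis
    unfolding tilde_def spectral_iff[OF QMax_ft_subset_Spec E] by blast
qed

end

section \<open>Comparison of the tilde operations of \<open>Nabla\<close> and
  \<open>Delta\<close>\<close>

lemma Delta_subset_Spec: "P \<in> Spec K D \<Longrightarrow> Delta K D P \<subseteq> Spec K D"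
  using MaxSpec_subset_Spec by (auto simp: Delta_def Nabla_def)

lemma Nabla_subset_Spec: "Nabla K D P \<subseteq> Spec K D"
  using MaxSpec_subset_Spec by (auto simp: Nabla_def)

text \<open>The operations differ exactly when some conductor is dense for \<open>Nabla\<close> but
  not for \<open>Delta\<close>. Its finite witness must then be contained in \<open>P\<close>, the
  only prime that \<open>Delta\<close> can add.\<close>

lemma semistar_less_tilde_iff:
  assumes P: "P \<in> Spec K D"
  shows "semistar_less K D (tilde K D (spectral K D (Delta K D P)))
      (tilde K D (spectral K D (Nabla K D P))) \<longleftrightarrow> dense (Nabla K D P) P"
proof -
  let ?delta = "tilde K D (spectral K D (Delta K D P))"
  let ?nabla = "tilde K D (spectral K D (Nabla K D P))"
  note delta_iff = tilde_spectral_iff[OF Delta_subset_Spec[OF P]]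
  note nabla_iff = tilde_spectral_iff[OF Nabla_subset_Spec]
  have le: "?delta E \<subseteq> ?nabla E" if "E \<in> submodules K D" for E
  proof
    fix x assume "x \<in> ?delta E"
    then show "x \<in> ?nabla E"
      unfolding delta_iff[OF that] nabla_iff[OF that]
      using dense_antimono[of "Delta K D P" _ "Nabla K D P"] by (auto simp: Delta_def)
  qed
  have "semistar_less K D ?delta ?nabla \<longleftrightarrow> (\<exists>E\<in>submodules K D. \<exists>x. x \<in> ?nabla E \<and> x \<notin> ?delta E)"
    using le by (intro semistar_less_iff) (simp add: semistar_le_def)
  also have "\<dots> \<longleftrightarrow> dense (Nabla K D P) P"
  proof
    assume "\<exists>E\<in>submodules K D. \<exists>x. x \<in> ?nabla E \<and> x \<notin> ?delta E"
    then obtain E x where "E \<in> submodules K D" "x \<in> ?nabla E" "x \<notin> ?delta E"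
      by blast
    then have "dense (Nabla K D P) {d \<in> D. d \<otimes> x \<in> E}" "\<not> dense (Delta K D P) {d \<in> D. d \<otimes> x \<in> E}"
      by (simp_all add: delta_iff nabla_iff)
    then show "dense (Nabla K D P) P"
      unfolding dense_def Delta_def by blast
  next
    assume dense: "dense (Nabla K D P) P"
    \<comment> \<open>Density supplies a nonzero element of \<open>P\<close>. This excludes the zero
      prime, for which \<open>Nabla\<close> is empty.\<close>
    have sub: "P \<in> submodules K D"
      using SpecD[OF P] dense by (auto simp: dense_def submodules_def)
    \<comment> \<open>The separating pair is \<open>E = P\<close> and \<open>x = \<one>\<close>,
      whose conductor is \<open>P\<close> itself.\<close>
    have "{d \<in> D. d \<otimes> \<one> \<in> P} = P"
      using SpecD(1)[OF P] by (auto simp: subset_iff)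
    moreover have "\<not> dense (Delta K D P) P"
      by (auto simp: dense_def Delta_def)
    ultimately have "\<one> \<in> ?nabla P" "\<one> \<notin> ?delta P"
      using dense by (simp_all add: delta_iff[OF sub] nabla_iff[OF sub])
    then show "\<exists>E\<in>submodules K D. \<exists>x. x \<in> ?nabla E \<and> x \<notin> ?delta E"
      using sub by blast
  qed
  finally show ?thesis .
qed

section \<open>Localizations and inverses of finitely generated ideals\<close>

lemma mem_localization_iff:
  assumes Q: "Q \<in> Spec K D"
  shows "x \<in> localization K D Q \<longleftrightarrow> x \<in> carrier K \<and> (\<exists>s\<in>D - Q. s \<otimes> x \<in> D)"
proof -
  have inv: "inv s \<in> carrier K" "s \<otimes> inv s = \<one>" if "s \<in> D - Q" for s
  proof -
    have "s \<in> Units K"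
      using that prime_complement(2)[OF Q] by (auto simp: field_Units)
    then show "inv s \<in> carrier K" "s \<otimes> inv s = \<one>"
      by simp_all
  qed
  show ?thesis
  proof
    assume "x \<in> localization K D Q"
    then obtain a s where as: "a \<in> D" "s \<in> D - Q" "x = a \<otimes> inv s"
      by (auto simp: localization_def)
    have "s \<otimes> x = a \<otimes> (s \<otimes> inv s)"
      unfolding as(3) using as(1,2) inv(1)[OF as(2)] by (simp add: m_ac)
    then have "s \<otimes> x \<in> D"
      using as(1) inv[OF as(2)] by simp
    then show "x \<in> carrier K \<and> (\<exists>s\<in>D - Q. s \<otimes> x \<in> D)"
      using as inv by auto
  next
    assume "x \<in> carrier K \<and> (\<exists>s\<in>D - Q. s \<otimes> x \<in> D)"
    then obtain s where s: "x \<in> carrier K" "s \<in> D - Q" "s \<otimes> x \<in> D"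
      by blast
    have "(s \<otimes> x) \<otimes> inv s = (s \<otimes> inv s) \<otimes> x"
      using s inv(1)[OF s(2)] by (simp add: m_ac)
    then have "x = (s \<otimes> x) \<otimes> inv s"
      using s inv[OF s(2)] by simp
    then show "x \<in> localization K D Q"
      using s unfolding localization_def by blast
  qed
qed

lemma genideal_sub_ring:
  assumes "S \<subseteq> D"
  shows "S \<subseteq> Idl\<^bsub>sub_ring K D\<^esub> S"
    "submodule E (sub_ring K D) (self_module K) \<Longrightarrow> E \<subseteq> D \<Longrightarrow> S \<subseteq> E \<Longrightarrow> Idl\<^bsub>sub_ring K D\<^esub> S \<subseteq> E"
proof -
  interpret D: domain "sub_ring K D"
    by (rule D_domain)
  show "S \<subseteq> Idl\<^bsub>sub_ring K D\<^esub> S"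
    using assms D.genideal_self by simp
  show "Idl\<^bsub>sub_ring K D\<^esub> S \<subseteq> E"
    if "submodule E (sub_ring K D) (self_module K)" "E \<subseteq> D" "S \<subseteq> E"
    using that by (intro D.genideal_minimal) (simp_all add: ideal_sub_ring_iff)
qed

lemma ideal_prod_mono:
  assumes "I \<subseteq> I'" "J \<subseteq> J'"
  shows "I \<cdot>\<^bsub>K\<^esub> J \<subseteq> I' \<cdot>\<^bsub>K\<^esub> J'"
proof
  fix x assume "x \<in> I \<cdot>\<^bsub>K\<^esub> J"
  then show "x \<in> I' \<cdot>\<^bsub>K\<^esub> J'"
    using assms by (induction rule: ideal_prod.induct) (auto intro: ideal_prod.intros)
qed

text \<open>The multipliers that carry \<open>J\<close> into \<open>a J + b J\<close> form an ideal
  \<open>N\<close> containing \<open>a\<close> and \<open>b\<close>, hence the ideal they generate.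
  Thus every product, and every sum of products, lies in \<open>a J + b J\<close>.\<close>

lemma two_generated_ideal_prod:
  assumes ab: "a \<in> D" "b \<in> D" and J: "submodule J (sub_ring K D) (self_module K)"
    and x: "x \<in> (Idl\<^bsub>sub_ring K D\<^esub> {a, b}) \<cdot>\<^bsub>K\<^esub> J"
  shows "\<exists>y\<in>J. \<exists>z\<in>J. x = a \<otimes> y \<oplus> b \<otimes> z"
proof -
  note J = J[unfolded submodule_iff]
  have Jc [simp]: "y \<in> carrier K" if "y \<in> J" for y
    using J that by blast
  define W where "W = {a \<otimes> y \<oplus> b \<otimes> z | y z. y \<in> J \<and> z \<in> J}"
  have W: "a \<otimes> y \<oplus> b \<otimes> z \<in> W" if "y \<in> J" "z \<in> J" for y z
    using that by (auto simp: W_def)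
  have Wc [simp]: "w \<in> carrier K" if "w \<in> W" for w
    using that ab by (auto simp: W_def)
  have W_add: "v \<oplus> w \<in> W" if vw: "v \<in> W" "w \<in> W" for v w
  proof -
    obtain y z where v: "v = a \<otimes> y \<oplus> b \<otimes> z" "y \<in> J" "z \<in> J"
      using vw(1) by (auto simp: W_def)
    obtain y' z' where w: "w = a \<otimes> y' \<oplus> b \<otimes> z'" "y' \<in> J" "z' \<in> J"
      using vw(2) by (auto simp: W_def)
    have "v \<oplus> w = a \<otimes> (y \<oplus> y') \<oplus> b \<otimes> (z \<oplus> z')"
      using ab v(2,3) w(2,3) unfolding v(1) w(1) by (simp add: r_distr a_ac)
    then show ?thesis
      using W[of "y \<oplus> y'" "z \<oplus> z'"] J v w by simp
  qed
  have W_smult: "d \<otimes> w \<in> W" if d: "d \<in> D" and w: "w \<in> W" for d w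
  proof -
    obtain y z where yz: "w = a \<otimes> y \<oplus> b \<otimes> z" "y \<in> J" "z \<in> J"
      using w by (auto simp: W_def)
    have "d \<otimes> w = a \<otimes> (d \<otimes> y) \<oplus> b \<otimes> (d \<otimes> z)"
      using ab d yz(2,3) unfolding yz(1) by (simp add: r_distr m_lcomm)
    then show ?thesis
      using W[of "d \<otimes> y" "d \<otimes> z"] J d yz by simp
  qed
  have zero: "\<zero> \<in> J"
    using J by blast
  have W_zero: "\<zero> \<in> W"
    using W[OF zero zero] ab by simp
  define N where "N = {i \<in> D. \<forall>j\<in>J. i \<otimes> j \<in> W}"
  have "submodule N (sub_ring K D) (self_module K)"
    unfolding submodule_iff N_def
    using W_add W_smult W_zero subringE(2,6,7)[OF D_subring] by (auto simp: l_distr m_assoc)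
  moreover have "a \<otimes> j \<in> W" "b \<otimes> j \<in> W" if "j \<in> J" for j
    using W[OF that zero] W[OF zero that] ab that by simp_all
  ultimately have "Idl\<^bsub>sub_ring K D\<^esub> {a, b} \<subseteq> N"
    using ab by (intro genideal_sub_ring(2)) (auto simp: N_def)
  then have "x \<in> W"
    using x W_add by (induction rule: ideal_prod.induct[OF x]) (auto simp: N_def)
  then show ?thesis
    by (auto simp: W_def)
qed

text \<open>
  If \<open>x = a / b\<close> and \<open>\<one> = a y + b z\<close> with \<open>y\<close>, \<open>z\<close> in the inverse of \<open>(a, b)\<close>, then \<open>{b z, b y}\<close>
  generates the conductor of \<open>x\<close> in \<open>D\<close>.
\<close>

lemma conductor_witness:
  assumes D: "pruefer_domain K D" and x: "x \<in> carrier K"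
  obtains u v where "u \<in> D" "v \<in> D" "u \<otimes> x \<in> D" "v \<otimes> x \<in> D" "u \<oplus> v \<otimes> x = \<one>"
proof -
  obtain a b where ab: "a \<in> D" "b \<in> D" "b \<noteq> \<zero>" "x = a \<otimes> inv b"
    using fraction[OF x] by blast
  let ?I = "Idl\<^bsub>sub_ring K D\<^esub> {a, b}"
  have sub: "{a, b} \<subseteq> ?I"
    using ab by (intro genideal_sub_ring(1)) simp
  then have "?I \<noteq> {\<zero>}"
    using ab by auto
  then obtain J where J: "J \<in> submodules K D" "?I \<cdot>\<^bsub>K\<^esub> J = D"
    using D ab unfolding pruefer_domain_def by (metis empty_subsetI finite.simps insert_subset)
  have "\<one> \<in> ?I \<cdot>\<^bsub>K\<^esub> J"
    using J subringE(3)[OF D_subring] by simp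
  then obtain y z where yz: "y \<in> J" "z \<in> J" "\<one> = a \<otimes> y \<oplus> b \<otimes> z"
    using two_generated_ideal_prod[OF ab(1,2)] J(1) unfolding submodules_def by blast
  have prod: "c \<otimes> w \<in> D" if "c \<in> {a, b}" "w \<in> J" for c w
    using that sub J(2) ideal_prod.prod[of c ?I w J K] by blast
  have [simp]: "y \<in> carrier K" "z \<in> carrier K" "a \<in> carrier K" "b \<in> carrier K"
    using yz J(1) ab by (auto simp: submodules_iff)
  have inv: "inv b \<in> carrier K" "b \<otimes> inv b = \<one>"
    using ab by (auto simp: field_Units)
  \<comment> \<open>As \<open>b x = a\<close>, multiplying \<open>b w\<close> by \<open>x\<close>
    gives \<open>a w\<close>. For \<open>w\<close> in \<open>J\<close> both are in \<open>D\<close>,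
    so \<open>b w\<close> is in the conductor of \<open>x\<close>.\<close>
  have bx: "b \<otimes> w \<otimes> x = a \<otimes> w" if "w \<in> carrier K" for w
  proof -
    have "b \<otimes> w \<otimes> x = a \<otimes> w \<otimes> (b \<otimes> inv b)"
      unfolding ab(4) using that inv(1) by (simp add: m_ac)
    then show ?thesis
      using inv that by simp
  qed
  show ?thesis
  proof (rule that[of "b \<otimes> z" "b \<otimes> y"])
    show "b \<otimes> z \<oplus> b \<otimes> y \<otimes> x = \<one>"
      unfolding yz(3) using bx by (simp add: a_comm)
  qed (use prod yz bx in auto)
qed

section \<open>Sharpness as density of \<open>P\<close> for \<open>Nabla\<close>\<close>

lemma sharp_iff_dense:
  assumes D: "pruefer_domain K D" and P: "P \<in> Spec K D"
  shows "sharp K D P \<longleftrightarrow> dense (Nabla K D P) P"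
proof
  assume "sharp K D P"
  then obtain x where x: "x \<in> carrier K" "\<forall>M\<in>Nabla K D P. x \<in> localization K D M"
      "x \<notin> localization K D P"
    by (auto simp: sharp_def Theta_def)
  obtain u v where uv: "u \<in> D" "v \<in> D" "u \<otimes> x \<in> D" "v \<otimes> x \<in> D" "u \<oplus> v \<otimes> x = \<one>"
    using conductor_witness[OF D x(1)] .
  \<comment> \<open>An element of \<open>{u, v}\<close> outside \<open>P\<close> would be a
    denominator that puts \<open>x\<close> into the localization at \<open>P\<close>.\<close>
  have "{u, v} \<subseteq> P"
    using x uv mem_localization_iff[OF P] by auto
  moreover have "\<not> {u, v} \<subseteq> {\<zero>}"
    using uv(5) x(1) by auto
  moreover have "\<not> {u, v} \<subseteq> M" if M: "M \<in> Nabla K D P" for M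
  proof
    assume sub: "{u, v} \<subseteq> M"
    have Spec: "M \<in> Spec K D"
      using M Nabla_subset_Spec by blast
    then obtain s where s: "s \<in> D - M" "s \<otimes> x \<in> D"
      using x(2) M mem_localization_iff by blast
    \<comment> \<open>Multiplying \<open>u + v x = 1\<close> by a denominator \<open>s\<close> of
      \<open>x\<close> at \<open>M\<close> expresses \<open>s\<close> as a
      \<open>D\<close>-combination of \<open>u\<close> and \<open>v\<close>.\<close>
    have "s \<otimes> u \<oplus> (s \<otimes> x) \<otimes> v = s \<otimes> (u \<oplus> v \<otimes> x)"
      using s uv(1,2) x(1) by (simp add: r_distr m_ac)
    also have "\<dots> = s"
      using s uv(5) by simp
    finally have "s = s \<otimes> u \<oplus> (s \<otimes> x) \<otimes> v" ..
    also have "\<dots> \<in> M"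
      using sub s SpecD(2)[OF Spec] by (simp add: submodule_iff)
    finally show False
      using s by simp
  qed
  ultimately show "dense (Nabla K D P) P"
    unfolding dense_def by (intro exI[of _ "{u, v}"]) simp
next
  assume dense: "dense (Nabla K D P) P"
  then obtain S where S: "finite S" "S \<subseteq> P" "\<not> S \<subseteq> {\<zero>}" "\<forall>M\<in>Nabla K D P. \<not> S \<subseteq> M"
    unfolding dense_def by blast
  let ?I = "Idl\<^bsub>sub_ring K D\<^esub> S"
  have SD: "S \<subseteq> D"
    using S SpecD[OF P] by blast
  have SI: "S \<subseteq> ?I"
    using genideal_sub_ring(1)[OF SD] .
  have IP: "?I \<subseteq> P"
    using genideal_sub_ring(2)[OF SD] SpecD[OF P] S by blast
  have "?I \<noteq> {\<zero>}"
    using SI S by auto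
  then obtain J where J: "J \<in> submodules K D" "?I \<cdot>\<^bsub>K\<^esub> J = D"
    using D S(1) SD unfolding pruefer_domain_def by blast
  have "J \<subseteq> Theta K D P"
  proof
    fix y assume y: "y \<in> J"
    then have yc: "y \<in> carrier K"
      using J(1) by (auto simp: submodules_iff)
    have "y \<in> localization K D M" if M: "M \<in> Nabla K D P" for M
    proof -
      \<comment> \<open>Any element of \<open>S\<close> outside \<open>M\<close> is a denominator
        for all of \<open>J\<close>, since it multiplies \<open>J\<close> into
        \<open>D\<close>.\<close>
      obtain s where s: "s \<in> S" "s \<notin> M"
        using S M by blast
      then have "s \<otimes> y \<in> D"
        using ideal_prod.prod[of s ?I y J K] SI y J(2) by blast
      moreover have "M \<in> Spec K D"
        using M Nabla_subset_Spec by blast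
      ultimately show ?thesis
        using mem_localization_iff[of M y] s SD yc by blast
    qed
    then show "y \<in> Theta K D P"
      using yc by (simp add: Theta_def)
  qed
  moreover have "\<not> J \<subseteq> localization K D P"
  proof
    assume "J \<subseteq> localization K D P"
    \<comment> \<open>Here \<open>\<one>\<close> belongs to \<open>D\<close>, the product of
      \<open>?I\<close> and \<open>J\<close>. Membership in \<open>P\<close> times its localization
      would yield a denominator outside \<open>P\<close> that lies in \<open>P\<close>.\<close>
    then have "\<one> \<in> P \<cdot>\<^bsub>K\<^esub> localization K D P"
      using ideal_prod_mono[OF IP] J(2) subringE(3)[OF D_subring] by blast
    moreover have "P \<in> submodules K D"
      using SpecD(2)[OF P] S by (auto simp: submodules_def)
    ultimately show False
      using mem_localized_iff[OF P] by auto
  qed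
  ultimately show "sharp K D P"
    unfolding sharp_def by blast
qed

end

theorem proposition2p2:
  fixes K :: "('a, 'b) ring_scheme" and D P :: "'a set"
  assumes "pruefer_domain K D"
    and "P \<in> Spec K D"
  shows "sharp K D P \<longleftrightarrow>
    semistar_less K D
      (tilde K D (spectral K D (Delta K D P)))
      (tilde K D (spectral K D (Nabla K D P)))"
proof -
  interpret quotient_field K D
    using assms(1) by (simp add: pruefer_domain_def)
  show ?thesis
    using sharp_iff_dense[OF assms] semistar_less_tilde_iff[OF assms(2)] by simp
qed

end
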